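(* There exist a smooth complete Riemannian manifold $(M,g)$ and, for each $k\in\mathbb{N}$, smooth functions $f^{k}:M\rightarrow\mathbb{R}$ and $u^{k}:M\rightarrow\mathbb{R}$ (here $k$ is an index, not a power) such that: 1) $Rc+\nabla^{2}f^{k}\geq 0$ on $M$ for every $k$; 2) $\triangle_{f^{k}}u^{k}=0$ on $M$ and $u^{k}>0$ for every $k$; 3) there exist points $x,y\in M$, fixed independently of $k$, such that $\lim_{k\to\infty}\frac{u^{k}(x)}{u^{k}(y)}=\infty$.
   Context: $Rc$ denotes the Ricci tensor of $g$ and $\nabla^{2}f$ the Hessian of $f$ with respect to $g$; inequalities between symmetric 2-tensors are in the sense of quadratic forms. For a smooth function $f$ on $M$, the $f$-Laplacian is the operator $\nabla^{*f}\nabla$ associated with the adjoint of $\nabla$ with respect to the measure $e^{-f}dv_{g}$, with the sign convention in which it generalizes the Laplace-Beltrami operator $\triangle=\mathrm{div}\nabla$; explicitly, $\triangle_{f}u=e^{f}\nabla^{i}(e^{-f}\nabla_{i}u)=\triangle u-\langle\nabla f,\nabla u\rangle$. *)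

theory Defs
  imports "HOL-Analysis.Analysis"
begin

text \<open>
  Riemannian manifolds of a dimension \<open>n\<close> that is a term, so that it can be quantified over:
  the model space is \<^term>\<open>Euclidean_space n\<close>, i.e. the set of all \<open>x :: nat \<Rightarrow> real\<close> with
  \<open>x i = 0\<close> for \<open>i \<ge> n\<close>. Coordinate indices run over \<open>{..<n}\<close>.
\<close>

subsection \<open>Smooth functions on open subsets of the model space\<close>

definition pd :: "nat \<Rightarrow> ((nat \<Rightarrow> real) \<Rightarrow> real) \<Rightarrow> (nat \<Rightarrow> real) \<Rightarrow> real" where
  "pd i F x = deriv (\<lambda>t. F (x(i := t))) (x i)"

fun pds :: "nat list \<Rightarrow> ((nat \<Rightarrow> real) \<Rightarrow> real) \<Rightarrow> (nat \<Rightarrow> real) \<Rightarrow> real" where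
  "pds [] F = F"
| "pds (i # is) F = pd i (pds is F)"

text \<open>
  For \<open>W\<close> open in \<^term>\<open>Euclidean_space n\<close>: all iterated partial derivatives exist and are
  continuous. The values of \<open>F\<close> outside \<open>W\<close> are irrelevant.
\<close>

definition smooth_on_open :: "nat \<Rightarrow> (nat \<Rightarrow> real) set \<Rightarrow> ((nat \<Rightarrow> real) \<Rightarrow> real) \<Rightarrow> bool" where
  "smooth_on_open n W F \<longleftrightarrow>
    (\<forall>is. set is \<subseteq> {..<n} \<longrightarrow>
       continuous_map (subtopology (Euclidean_space n) W) euclideanreal (pds is F) \<and>
       (\<forall>i<n. \<forall>x\<in>W. (\<lambda>t. pds is F (x(i := t))) differentiable (at (x i))))"

subsection \<open>Smooth manifolds\<close>

text \<open>
  A chart is a pair \<open>(U, \<phi>)\<close>; \<open>\<phi>\<close> is only meaningful on \<open>U\<close>. A tangent vector at a point acts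
  as a derivation on the smooth functions of the manifold, and as \<open>0\<close> on all other functions (so
  that equality of tangent vectors is equality of functionals). The field \<open>metr\<close> assigns to each
  point the scalar product on its tangent space.
\<close>

type_synonym 'a chart = "'a set \<times> ('a \<Rightarrow> nat \<Rightarrow> real)"
type_synonym 'a tvec = "('a \<Rightarrow> real) \<Rightarrow> real"

record 'a manifold_data =
  mdim :: nat
  mtop :: "'a topology"
  atlas :: "'a chart set"
  metr :: "'a \<Rightarrow> 'a tvec \<Rightarrow> 'a tvec \<Rightarrow> real"

definition chart_image :: "'a chart \<Rightarrow> (nat \<Rightarrow> real) set" where
  "chart_image c = snd c ` fst c"

definition chart_inv :: "'a chart \<Rightarrow> (nat \<Rightarrow> real) \<Rightarrow> 'a" where
  "chart_inv c = inv_into (fst c) (snd c)"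

definition is_chart :: "nat \<Rightarrow> 'a topology \<Rightarrow> 'a chart \<Rightarrow> bool" where
  "is_chart n X c \<longleftrightarrow>
     openin X (fst c) \<and> openin (Euclidean_space n) (chart_image c) \<and>
     homeomorphic_map (subtopology X (fst c))
       (subtopology (Euclidean_space n) (chart_image c)) (snd c)"

text \<open>
  Applied to all ordered pairs of charts, the following says that all transition maps are
  diffeomorphisms.
\<close>

definition smooth_transition :: "nat \<Rightarrow> 'a chart \<Rightarrow> 'a chart \<Rightarrow> bool" where
  "smooth_transition n c d \<longleftrightarrow>
     (\<forall>i<n. smooth_on_open n (snd c ` (fst c \<inter> fst d)) (\<lambda>x. snd d (chart_inv c x) i))"

definition smooth_manifold :: "('a, 'm) manifold_data_scheme \<Rightarrow> bool" where
  "smooth_manifold M \<longleftrightarrow>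
     Hausdorff_space (mtop M) \<and> second_countable (mtop M) \<and> connected_space (mtop M) \<and>
     (\<forall>c\<in>atlas M. is_chart (mdim M) (mtop M) c) \<and>
     (\<Union>c\<in>atlas M. fst c) = topspace (mtop M) \<and>
     (\<forall>c\<in>atlas M. \<forall>d\<in>atlas M. smooth_transition (mdim M) c d)"

definition in_chart :: "'a chart \<Rightarrow> ('a \<Rightarrow> real) \<Rightarrow> (nat \<Rightarrow> real) \<Rightarrow> real" where
  "in_chart c f = (\<lambda>x. f (chart_inv c x))"

definition smooth_fun :: "('a, 'm) manifold_data_scheme \<Rightarrow> ('a \<Rightarrow> real) \<Rightarrow> bool" where
  "smooth_fun M f \<longleftrightarrow> (\<forall>c\<in>atlas M. smooth_on_open (mdim M) (chart_image c) (in_chart c f))"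

text \<open>The coordinate vector \<open>\<partial>\<^sub>i\<close> of the chart \<open>c\<close> at the point \<open>p\<close>.\<close>

definition coord_vec :: "('a, 'm) manifold_data_scheme \<Rightarrow> 'a chart \<Rightarrow> nat \<Rightarrow> 'a \<Rightarrow> 'a tvec" where
  "coord_vec M c i p = (\<lambda>f. if smooth_fun M f then pd i (in_chart c f) (snd c p) else 0)"

definition tangent_space :: "('a, 'm) manifold_data_scheme \<Rightarrow> 'a \<Rightarrow> 'a tvec set" where
  "tangent_space M p =
     {v. \<exists>c\<in>atlas M. p \<in> fst c \<and> (\<exists>a. v = (\<lambda>f. \<Sum>i<mdim M. a i * coord_vec M c i p f))}"

subsection \<open>Riemannian metrics\<close>

definition is_inner_product :: "('a, 'm) manifold_data_scheme \<Rightarrow> 'a \<Rightarrow> bool" where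
  "is_inner_product M p \<longleftrightarrow>
     (\<forall>u\<in>tangent_space M p. \<forall>v\<in>tangent_space M p. \<forall>w\<in>tangent_space M p. \<forall>a b.
        metr M p (\<lambda>f. a * u f + b * v f) w = a * metr M p u w + b * metr M p v w) \<and>
     (\<forall>u\<in>tangent_space M p. \<forall>v\<in>tangent_space M p. metr M p u v = metr M p v u) \<and>
     (\<forall>v\<in>tangent_space M p. v \<noteq> (\<lambda>_. 0) \<longrightarrow> metr M p v v > 0)"

text \<open>
  From here on, local expressions are functions of the coordinates \<open>x \<in> chart_image c\<close>:
  \<open>g\<^sub>i\<^sub>j\<close>, its inverse matrix \<open>g\<^sup>i\<^sup>j\<close>, and the Christoffel symbols \<open>\<Gamma>\<^sup>k\<^sub>i\<^sub>j\<close> of the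
  Levi-Civita connection.
\<close>

definition metric_coeff ::
  "('a, 'm) manifold_data_scheme \<Rightarrow> 'a chart \<Rightarrow> nat \<Rightarrow> nat \<Rightarrow> (nat \<Rightarrow> real) \<Rightarrow> real" where
  "metric_coeff M c i j x =
     metr M (chart_inv c x) (coord_vec M c i (chart_inv c x)) (coord_vec M c j (chart_inv c x))"

definition riemannian_manifold :: "('a, 'm) manifold_data_scheme \<Rightarrow> bool" where
  "riemannian_manifold M \<longleftrightarrow>
     smooth_manifold M \<and> (\<forall>p\<in>topspace (mtop M). is_inner_product M p) \<and>
     (\<forall>c\<in>atlas M. \<forall>i<mdim M. \<forall>j<mdim M.
        smooth_on_open (mdim M) (chart_image c) (metric_coeff M c i j))"

text \<open>
  The inverse of the \<open>n \<times> n\<close> matrix \<open>A\<close>, extended by zero; arbitrary for singular \<open>A\<close>.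
\<close>

definition inv_mat :: "nat \<Rightarrow> (nat \<Rightarrow> nat \<Rightarrow> real) \<Rightarrow> nat \<Rightarrow> nat \<Rightarrow> real" where
  "inv_mat n A = (THE B. (\<forall>i j. i \<ge> n \<or> j \<ge> n \<longrightarrow> B i j = 0) \<and>
     (\<forall>i<n. \<forall>j<n. (\<Sum>k<n. B i k * A k j) = (if i = j then 1 else 0)))"

definition metric_inv ::
  "('a, 'm) manifold_data_scheme \<Rightarrow> 'a chart \<Rightarrow> nat \<Rightarrow> nat \<Rightarrow> (nat \<Rightarrow> real) \<Rightarrow> real" where
  "metric_inv M c i j x = inv_mat (mdim M) (\<lambda>k l. metric_coeff M c k l x) i j"

definition christoffel ::
  "('a, 'm) manifold_data_scheme \<Rightarrow> 'a chart \<Rightarrow> nat \<Rightarrow> nat \<Rightarrow> nat \<Rightarrow> (nat \<Rightarrow> real) \<Rightarrow> real" where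
  "christoffel M c k i j x =
     (\<Sum>l<mdim M. metric_inv M c k l x *
        (pd i (metric_coeff M c j l) x + pd j (metric_coeff M c i l) x
          - pd l (metric_coeff M c i j) x)) / 2"

subsection \<open>Curvature and differential operators\<close>

text \<open>
  \<open>R(\<partial>\<^sub>i, \<partial>\<^sub>j) \<partial>\<^sub>k = \<Sum>l. riemann M c l i j k \<partial>\<^sub>l\<close> with
  \<open>R(X, Y) Z = \<nabla>\<^sub>X \<nabla>\<^sub>Y Z - \<nabla>\<^sub>Y \<nabla>\<^sub>X Z - \<nabla>\<^bsub>[X, Y]\<^esub> Z\<close>, and \<open>Ric(Y, Z)\<close> is the
  trace of \<open>X \<mapsto> R(X, Y) Z\<close>, so that round spheres have positive Ricci curvature.
\<close>

definition riemann ::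
  "('a, 'm) manifold_data_scheme \<Rightarrow> 'a chart \<Rightarrow> nat \<Rightarrow> nat \<Rightarrow> nat \<Rightarrow> nat \<Rightarrow> (nat \<Rightarrow> real) \<Rightarrow> real"
  where
  "riemann M c l i j k x =
     pd i (christoffel M c l j k) x - pd j (christoffel M c l i k) x
     + (\<Sum>p<mdim M. christoffel M c l i p x * christoffel M c p j k x
                   - christoffel M c l j p x * christoffel M c p i k x)"

definition ricci ::
  "('a, 'm) manifold_data_scheme \<Rightarrow> 'a chart \<Rightarrow> nat \<Rightarrow> nat \<Rightarrow> (nat \<Rightarrow> real) \<Rightarrow> real" where
  "ricci M c j k x = (\<Sum>i<mdim M. riemann M c i i j k x)"

text \<open>The covariant derivative \<open>(\<nabla>\<^sub>i \<omega>)\<^sub>j\<close> of the one-form \<open>\<Sum>j. \<omega> j dx\<^sup>j\<close>.\<close>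

definition cov_deriv ::
  "('a, 'm) manifold_data_scheme \<Rightarrow> 'a chart \<Rightarrow> (nat \<Rightarrow> (nat \<Rightarrow> real) \<Rightarrow> real) \<Rightarrow>
     nat \<Rightarrow> nat \<Rightarrow> (nat \<Rightarrow> real) \<Rightarrow> real" where
  "cov_deriv M c \<omega> i j x = pd i (\<omega> j) x - (\<Sum>k<mdim M. christoffel M c k i j x * \<omega> k x)"

definition hessian ::
  "('a, 'm) manifold_data_scheme \<Rightarrow> 'a chart \<Rightarrow> ('a \<Rightarrow> real) \<Rightarrow> nat \<Rightarrow> nat \<Rightarrow> (nat \<Rightarrow> real) \<Rightarrow> real"
  where
  "hessian M c f = cov_deriv M c (\<lambda>j. pd j (in_chart c f))"

text \<open>\<open>\<triangle>\<^sub>f u = e\<^sup>f \<nabla>\<^sup>i (e\<^bsup>-f\<^esup> \<nabla>\<^sub>i u)\<close>, the index being raised by \<open>g\<^sup>i\<^sup>j\<close>.\<close>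

definition f_laplacian ::
  "('a, 'm) manifold_data_scheme \<Rightarrow> 'a chart \<Rightarrow> ('a \<Rightarrow> real) \<Rightarrow> ('a \<Rightarrow> real) \<Rightarrow> (nat \<Rightarrow> real) \<Rightarrow> real"
  where
  "f_laplacian M c f u x =
     exp (in_chart c f x) *
     (\<Sum>i<mdim M. \<Sum>j<mdim M. metric_inv M c i j x *
        cov_deriv M c (\<lambda>j y. exp (- in_chart c f y) * pd j (in_chart c u) y) i j x)"

text \<open>\<open>Rc + \<nabla>\<^sup>2 f \<ge> 0\<close>: at every point the quadratic form is nonnegative on every tangent
  vector \<open>\<Sum>i. a i \<partial>\<^sub>i\<close>.\<close>

definition bakry_emery_nonneg :: "('a, 'm) manifold_data_scheme \<Rightarrow> ('a \<Rightarrow> real) \<Rightarrow> bool" where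
  "bakry_emery_nonneg M f \<longleftrightarrow>
     (\<forall>c\<in>atlas M. \<forall>x\<in>chart_image c. \<forall>a :: nat \<Rightarrow> real.
        (\<Sum>i<mdim M. \<Sum>j<mdim M. (ricci M c i j x + hessian M c f i j x) * a i * a j) \<ge> 0)"

definition f_harmonic ::
  "('a, 'm) manifold_data_scheme \<Rightarrow> ('a \<Rightarrow> real) \<Rightarrow> ('a \<Rightarrow> real) \<Rightarrow> bool" where
  "f_harmonic M f u \<longleftrightarrow> (\<forall>c\<in>atlas M. \<forall>x\<in>chart_image c. f_laplacian M c f u x = 0)"

subsection \<open>Geodesics and completeness\<close>

definition velocity :: "('a, 'm) manifold_data_scheme \<Rightarrow> (real \<Rightarrow> 'a) \<Rightarrow> real \<Rightarrow> 'a tvec" where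
  "velocity M \<gamma> t = (\<lambda>f. if smooth_fun M f then deriv (\<lambda>s. f (\<gamma> s)) t else 0)"

text \<open>
  Geodesics defined on the whole real line. Because \<open>\<gamma>\<close> is continuous and charts are open, it
  stays in a chart for a short time, so the derivatives below do not see the values of a chart
  outside its domain.
\<close>

definition geodesic_line :: "('a, 'm) manifold_data_scheme \<Rightarrow> (real \<Rightarrow> 'a) \<Rightarrow> bool" where
  "geodesic_line M \<gamma> \<longleftrightarrow>
     continuous_map euclideanreal (mtop M) \<gamma> \<and>
     (\<forall>c\<in>atlas M. \<forall>t. \<gamma> t \<in> fst c \<longrightarrow>
       (\<forall>k<mdim M.
          (\<lambda>s. snd c (\<gamma> s) k) differentiable (at t) \<and>
          (deriv (\<lambda>s. snd c (\<gamma> s) k) has_real_derivative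
             - (\<Sum>i<mdim M. \<Sum>j<mdim M. christoffel M c k i j (snd c (\<gamma> t)) *
                  deriv (\<lambda>s. snd c (\<gamma> s) i) t * deriv (\<lambda>s. snd c (\<gamma> s) j) t)) (at t)))"

text \<open>Every geodesic extends to the real line (the exponential map is defined on all tangent
  vectors).\<close>

definition complete_riemannian :: "('a, 'm) manifold_data_scheme \<Rightarrow> bool" where
  "complete_riemannian M \<longleftrightarrow>
     riemannian_manifold M \<and>
     (\<forall>p\<in>topspace (mtop M). \<forall>v\<in>tangent_space M p.
        \<exists>\<gamma>. geodesic_line M \<gamma> \<and> \<gamma> 0 = p \<and> velocity M \<gamma> 0 = v)"

text \<open>
  HOL cannot quantify over the type of points inside a formula. Since the topology is an
  arbitrary one on a subset of the point type, this is no restriction for a type of the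
  cardinality of the continuum: every connected second countable manifold is in bijection with
  a subset of \<open>nat \<Rightarrow> real\<close>, along which its structure can be transported.
\<close>

type_synonym manifold = "(nat \<Rightarrow> real) manifold_data"

end

theory Submission
  imports Defs
begin

text \<open>
  The bound \<open>Rc + \<nabla>\<^sup>2 f \<ge> 0\<close> alone gives no Harnack inequality for positive \<open>f\<close>-harmonic
  functions, because it does not control the gradient of \<open>f\<close>. The flat line \<open>\<real>\<close> already
  shows this. Its curvature vanishes, and a linear function \<open>f\<^sup>k(t) = k t\<close> has vanishing
  Hessian whatever its slope, so \<open>Rc + \<nabla>\<^sup>2 f\<^sup>k = 0\<close>. The equation
  \<open>\<triangle>\<^bsub>f\<^esub> u = u'' - k u' = 0\<close> has the positive solution \<open>u\<^sup>k(t) = e\<^bsup>k t\<^esup>\<close>, and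
  \<open>u\<^sup>k(1) / u\<^sup>k(0) = e\<^bsup>k\<^esup>\<close> tends to infinity.

  What has to be verified is that the line, given by its single global chart, is a complete
  Riemannian manifold in the sense of the definitions. There are two sources of work. Partial
  derivatives are taken in \<^typ>\<open>nat \<Rightarrow> real\<close> while chart expressions are determined only on the
  image of the chart; \<open>pds_cong\<close> reconciles the two, since varying one of the first \<open>n\<close>
  coordinates does not leave the model space. And every function that occurs (constants,
  the coordinate, \<open>f\<^sup>k\<close>, \<open>u\<^sup>k\<close>) must be smooth; \<open>smooth_on_open_exp_affine\<close> treats them together.
\<close>

section \<open>Iterated partial derivatives on the model space\<close>

lemma fun_upd_in_Euclidean_space:
  assumes "x \<in> topspace (Euclidean_space n)" "i < n"
  shows "x(i := t) \<in> topspace (Euclidean_space n)"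
  using assms by (auto simp: topspace_Euclidean_space)

lemma pd_cong:
  assumes "\<And>y. y \<in> topspace (Euclidean_space n) \<Longrightarrow> F y = G y"
    and "x \<in> topspace (Euclidean_space n)" "i < n"
  shows "pd i F x = pd i G x"
  using assms by (simp add: pd_def fun_upd_in_Euclidean_space)

lemma pds_cong:
  assumes "\<And>y. y \<in> topspace (Euclidean_space n) \<Longrightarrow> F y = G y"
    and "set is \<subseteq> {..<n}" "x \<in> topspace (Euclidean_space n)"
  shows "pds is F x = pds is G x"
  using assms(2,3)
proof (induction "is" arbitrary: x)
  case Nil
  then show ?case by (simp add: assms(1))
next
  case (Cons i "is")
  then show ?case by (auto intro!: pd_cong)
qed

lemma smooth_on_open_cong:
  assumes "\<And>y. y \<in> topspace (Euclidean_space n) \<Longrightarrow> F y = G y"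
    and "smooth_on_open n (topspace (Euclidean_space n)) F"
  shows "smooth_on_open n (topspace (Euclidean_space n)) G"
  unfolding smooth_on_open_def
proof (intro allI impI conjI ballI)
  fix "is" assume "is": "set is \<subseteq> {..<n}"
  note eq = pds_cong[of n F G, OF assms(1) "is"]
  show "continuous_map (subtopology (Euclidean_space n) (topspace (Euclidean_space n)))
      euclideanreal (pds is G)"
    using assms(2) "is" eq unfolding smooth_on_open_def by (auto elim!: continuous_map_eq)
  fix i x assume "i < n" and "x \<in> topspace (Euclidean_space n)"
  then have "(\<lambda>t. pds is F (x(i := t))) = (\<lambda>t. pds is G (x(i := t)))"
    by (intro ext eq) (auto intro: fun_upd_in_Euclidean_space)
  then show "(\<lambda>t. pds is G (x(i := t))) differentiable at (x i)"
    using assms(2) "is" \<open>i < n\<close> \<open>x \<in> _\<close> unfolding smooth_on_open_def by metis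
qed

lemma pd_const: "pd i (\<lambda>_. c) = (\<lambda>_. 0)"
  by (simp add: pd_def fun_eq_iff)

lemma pd_exp_affine:
  "pd i (\<lambda>x. A * exp (a * x m) + B * x m + C) =
    (\<lambda>x. if i = m then A * a * exp (a * x m) + B else 0)"
proof
  fix x :: "nat \<Rightarrow> real"
  have "((\<lambda>t. A * exp (a * t) + B * t + C) has_real_derivative
      A * a * exp (a * x m) + B) (at (x m))"
    by (auto intro!: derivative_eq_intros)
  then show "pd i (\<lambda>x. A * exp (a * x m) + B * x m + C) x =
      (if i = m then A * a * exp (a * x m) + B else 0)"
    by (simp add: pd_def DERIV_imp_deriv)
qed

lemma pds_exp_affine:
  "\<exists>A' B' C'. pds is (\<lambda>x. A * exp (a * x m) + B * x m + C) =
    (\<lambda>x. A' * exp (a * x m) + B' * x m + C')"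
proof (induction "is")
  case Nil
  then show ?case by auto
next
  case (Cons i "is")
  then obtain A' B' C' where "pds is (\<lambda>x. A * exp (a * x m) + B * x m + C) =
      (\<lambda>x. A' * exp (a * x m) + B' * x m + C')"
    by blast
  then have "pds (i # is) (\<lambda>x. A * exp (a * x m) + B * x m + C) =
      (\<lambda>x. (if i = m then A' * a else 0) * exp (a * x m) + 0 * x m + (if i = m then B' else 0))"
    by (auto simp: pd_exp_affine)
  then show ?case by blast
qed

text \<open>
  The family \<open>A e\<^bsup>a x\<^esup> + B x + C\<close> is closed under partial derivatives, so one
  check of continuity and of differentiability covers the derivatives of all orders.
\<close>

lemma smooth_on_open_exp_affine:
  "smooth_on_open n W (\<lambda>x. A * exp (a * x m) + B * x m + C)"
  unfolding smooth_on_open_def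
proof (intro allI impI)
  fix "is" :: "nat list"
  obtain A' B' C' where eq: "pds is (\<lambda>x. A * exp (a * x m) + B * x m + C) =
      (\<lambda>x. A' * exp (a * x m) + B' * x m + C')"
    using pds_exp_affine by blast
  have "continuous_on UNIV (\<lambda>x :: nat \<Rightarrow> real. A' * exp (a * x m) + B' * x m + C')"
    by (intro continuous_intros continuous_on_product_coordinates)
  then have "continuous_map (powertop_real UNIV) euclideanreal
      (\<lambda>x. A' * exp (a * x m) + B' * x m + C')"
    by (simp add: euclidean_product_topology)
  moreover have "((\<lambda>t. A' * exp (a * t) + B' * t + C') has_real_derivative
      A' * a * exp (a * s) + B') (at s)" for s
    by (auto intro!: derivative_eq_intros)
  then have "(\<lambda>t. A' * exp (a * (x(i := t)) m) + B' * (x(i := t)) m + C')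
      differentiable at (x i)" for i and x :: "nat \<Rightarrow> real"
    by (cases "i = m") (auto simp: real_differentiable_def)
  ultimately show "continuous_map (subtopology (Euclidean_space n) W) euclideanreal
        (pds is (\<lambda>x. A * exp (a * x m) + B * x m + C)) \<and>
      (\<forall>i<n. \<forall>x\<in>W. (\<lambda>t. pds is (\<lambda>x. A * exp (a * x m) + B * x m + C) (x(i := t)))
        differentiable at (x i))"
    by (simp add: eq Euclidean_space_def continuous_map_from_subtopology)
qed

lemma smooth_on_open_const: "smooth_on_open n W (\<lambda>_. c)"
  using smooth_on_open_exp_affine[of n W 0 0 0 0 c] by simp

lemma smooth_on_open_coordinate: "smooth_on_open n W (\<lambda>x. c * x m)"
  using smooth_on_open_exp_affine[of n W 0 0 m c 0] by simp

lemma smooth_on_open_exp: "smooth_on_open n W (\<lambda>x. exp (c * x m))"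
  using smooth_on_open_exp_affine[of n W 1 c m 0 0] by simp

lemma pd_coordinate: "pd m (\<lambda>x. c * x m) = (\<lambda>_. c)"
  using pd_exp_affine[of m 0 0 m c 0] by simp

lemma pd_exp: "pd m (\<lambda>x. exp (c * x m)) = (\<lambda>x. c * exp (c * x m))"
  using pd_exp_affine[of m 1 c m 0 0] by simp

section \<open>The flat line\<close>

abbreviation line_space :: "(nat \<Rightarrow> real) set" where
  "line_space \<equiv> topspace (Euclidean_space 1)"

definition line_chart :: "(nat \<Rightarrow> real) chart" where
  "line_chart = (line_space, \<lambda>x. x)"

text \<open>
  A tangent vector is a derivation, so its component along \<open>\<partial>\<^sub>0\<close> is its value on the
  coordinate function; the scalar product below is therefore \<open>dt \<otimes> dt\<close>.
\<close>

definition flat_line :: manifold where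
  "flat_line = \<lparr>mdim = 1, mtop = Euclidean_space 1, atlas = {line_chart},
     metr = (\<lambda>p v w. v (\<lambda>q. q 0) * w (\<lambda>q. q 0))\<rparr>"

lemma flat_line_simps [simp]:
  "mdim flat_line = 1" "mtop flat_line = Euclidean_space 1" "atlas flat_line = {line_chart}"
  "metr flat_line p v w = v (\<lambda>q. q 0) * w (\<lambda>q. q 0)"
  by (simp_all add: flat_line_def)

lemma line_chart_simps [simp]:
  "fst line_chart = line_space" "snd line_chart = (\<lambda>x. x)" "chart_image line_chart = line_space"
  by (simp_all add: line_chart_def chart_image_def)

lemma chart_inv_line_chart [simp]: "x \<in> line_space \<Longrightarrow> chart_inv line_chart x = x"
  unfolding chart_inv_def line_chart_simps by (rule inv_into_f_f[of "\<lambda>x. x"]) (auto simp: inj_on_def)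

lemma in_chart_line_chart [simp]: "x \<in> line_space \<Longrightarrow> in_chart line_chart f x = f x"
  by (simp add: in_chart_def)

lemma pd_in_chart_line_chart [simp]:
  "x \<in> line_space \<Longrightarrow> pd 0 (in_chart line_chart f) x = pd 0 f x"
  by (rule pd_cong) auto

lemma smooth_fun_flat_line:
  assumes "smooth_on_open 1 line_space f"
  shows "smooth_fun flat_line f"
  using assms by (auto simp: smooth_fun_def intro: smooth_on_open_cong[rotated])

lemma second_countable_Euclidean_space: "second_countable (Euclidean_space n)"
proof -
  obtain \<B> :: "(nat \<Rightarrow> real) set set"
    where \<B>: "countable \<B>" "\<And>C. C \<in> \<B> \<Longrightarrow> open C" "\<And>S. open S \<Longrightarrow> \<exists>U. U \<subseteq> \<B> \<and> S = \<Union>U"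
    using univ_second_countable by blast
  have "second_countable (euclidean :: (nat \<Rightarrow> real) topology)"
    unfolding second_countable_def
  proof (intro exI[of _ \<B>] conjI allI impI ballI)
    show "\<exists>U\<in>\<B>. x \<in> U \<and> U \<subseteq> V" if "openin euclidean V \<and> x \<in> V" for V x
      using that \<B>(3)[of V] by auto
  qed (use \<B> in auto)
  then show ?thesis
    by (simp add: Euclidean_space_def euclidean_product_topology second_countable_subtopology)
qed

lemma smooth_manifold_flat_line: "smooth_manifold flat_line"
proof -
  have "is_chart 1 (Euclidean_space 1) line_chart"
    unfolding is_chart_def using homeomorphic_map_id[of "Euclidean_space 1"] by (simp add: id_def)
  moreover have "smooth_transition 1 line_chart line_chart"
    using smooth_on_open_cong[of 1 "\<lambda>x. 1 * x 0" "\<lambda>x. chart_inv line_chart x 0",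
        OF _ smooth_on_open_coordinate]
    by (simp add: smooth_transition_def)
  ultimately show ?thesis
    by (simp add: smooth_manifold_def Hausdorff_Euclidean_space second_countable_Euclidean_space
        connected_Euclidean_space)
qed

lemma coord_vec_flat_line:
  assumes "p \<in> line_space"
  shows "coord_vec flat_line line_chart 0 p f = (if smooth_fun flat_line f then pd 0 f p else 0)"
  using assms by (simp add: coord_vec_def)

lemma coord_vec_coordinate:
  assumes "p \<in> line_space"
  shows "coord_vec flat_line line_chart 0 p (\<lambda>q. q 0) = 1"
  using smooth_fun_flat_line[OF smooth_on_open_coordinate[of 1 line_space 1 0]]
    pd_coordinate[of 0 1] assms
  by (simp add: coord_vec_flat_line)

lemma tangent_space_flat_line:
  assumes "v \<in> tangent_space flat_line p"
  obtains a where "p \<in> line_space" "v = (\<lambda>f. a * coord_vec flat_line line_chart 0 p f)"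
  using assms by (auto simp: tangent_space_def lessThan_Suc)

lemma metric_coeff_flat_line:
  assumes "x \<in> line_space"
  shows "metric_coeff flat_line line_chart 0 0 x = 1"
  using assms by (simp add: metric_coeff_def coord_vec_coordinate)

lemma is_inner_product_flat_line: "is_inner_product flat_line p"
proof -
  have "v (\<lambda>q. q 0) * v (\<lambda>q. q 0) > 0"
    if v: "v \<in> tangent_space flat_line p" "v \<noteq> (\<lambda>_. 0)" for v
    using v(1)
  proof (cases rule: tangent_space_flat_line)
    case (1 a)
    then have "a \<noteq> 0" using v(2) by auto
    then show ?thesis
      using 1 by (auto simp: coord_vec_coordinate zero_less_mult_iff)
  qed
  then show ?thesis
    by (simp add: is_inner_product_def algebra_simps)
qed

lemma riemannian_manifold_flat_line: "riemannian_manifold flat_line"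
proof -
  have "smooth_on_open 1 line_space (metric_coeff flat_line line_chart 0 0)"
    by (rule smooth_on_open_cong[OF _ smooth_on_open_const[of _ _ 1]])
      (simp add: metric_coeff_flat_line)
  then show ?thesis
    by (simp add: riemannian_manifold_def smooth_manifold_flat_line is_inner_product_flat_line)
qed

section \<open>Curvature and completeness of the flat line\<close>

lemma inv_mat_one:
  assumes "A 0 0 = 1"
  shows "inv_mat 1 A 0 0 = 1"
proof -
  have "inv_mat 1 A = (\<lambda>i j. if i = 0 \<and> j = 0 then 1 else 0)"
    unfolding inv_mat_def using assms
    by (intro the_equality) (auto simp: fun_eq_iff Suc_le_eq)
  then show ?thesis by simp
qed

lemma metric_inv_flat_line:
  assumes "x \<in> line_space"
  shows "metric_inv flat_line line_chart 0 0 x = 1"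
  unfolding metric_inv_def flat_line_simps
  by (intro inv_mat_one metric_coeff_flat_line assms)

lemma christoffel_flat_line:
  assumes "x \<in> line_space"
  shows "christoffel flat_line line_chart 0 0 0 x = 0"
proof -
  have "pd 0 (metric_coeff flat_line line_chart 0 0) x = pd 0 (\<lambda>_. 1) x"
    using assms by (intro pd_cong) (auto simp: metric_coeff_flat_line)
  then show ?thesis
    by (simp add: christoffel_def lessThan_Suc pd_const)
qed

text \<open>
  With a single index, the antisymmetric pair of the curvature tensor makes its terms cancel.
\<close>

lemma ricci_flat_line: "ricci flat_line line_chart 0 0 x = 0"
  by (simp add: ricci_def riemann_def lessThan_Suc)

lemma cov_deriv_flat_line:
  assumes "x \<in> line_space"
  shows "cov_deriv flat_line line_chart \<omega> 0 0 x = pd 0 (\<omega> 0) x"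
  using assms by (simp add: cov_deriv_def lessThan_Suc christoffel_flat_line)

lemma hessian_flat_line:
  assumes "x \<in> line_space"
  shows "hessian flat_line line_chart f 0 0 x = pd 0 (pd 0 f) x"
  using assms by (auto simp: hessian_def cov_deriv_flat_line intro!: pd_cong)

lemma f_laplacian_flat_line:
  assumes "x \<in> line_space"
  shows "f_laplacian flat_line line_chart f u x = exp (f x) * pd 0 (\<lambda>y. exp (- f y) * pd 0 u y) x"
  using assms
  by (auto simp: f_laplacian_def lessThan_Suc metric_inv_flat_line cov_deriv_flat_line
      intro!: pd_cong)

text \<open>
  The Christoffel symbol vanishes, so geodesics are the affine curves, which exist for all times.
\<close>

lemma affine_curve_in_line:
  assumes "p \<in> line_space"
  shows "continuous_map euclideanreal (Euclidean_space 1) (\<lambda>s. p(0 := p 0 + s * a))"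
proof -
  have "continuous_map euclideanreal euclideanreal (\<lambda>s. (p(0 := p 0 + s * a)) i)" for i
    by (cases "i = 0") (auto intro!: continuous_intros)
  then have "continuous_map euclideanreal (powertop_real UNIV) (\<lambda>s. p(0 := p 0 + s * a))"
    by (simp add: continuous_map_componentwise_UNIV)
  then show ?thesis
    using assms by (auto simp: Euclidean_space_def continuous_map_in_subtopology)
qed

lemma geodesic_line_affine_curve:
  assumes "p \<in> line_space"
  shows "geodesic_line flat_line (\<lambda>s. p(0 := p 0 + s * a))"
proof -
  have deriv: "deriv (\<lambda>s. p 0 + s * a) = (\<lambda>_. a)"
    by (intro ext DERIV_imp_deriv) (auto intro!: derivative_eq_intros)
  have diff: "(\<lambda>s. p 0 + s * a) differentiable at t" for t
    by (intro derivative_intros)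
  show ?thesis
    unfolding geodesic_line_def
    using assms affine_curve_in_line[OF assms, of a]
    by (auto simp: lessThan_Suc deriv diff christoffel_flat_line)
qed

text \<open>
  The curve moves along the only coordinate axis, so the chain rule in one variable suffices:
  it needs no more than the partial differentiability contained in smoothness.
\<close>

lemma velocity_affine_curve:
  assumes "p \<in> line_space"
  shows "velocity flat_line (\<lambda>s. p(0 := p 0 + s * a)) 0 =
    (\<lambda>f. a * coord_vec flat_line line_chart 0 p f)"
proof -
  have "deriv (\<lambda>s. f (p(0 := p 0 + s * a))) 0 = a * pd 0 f p" if f: "smooth_fun flat_line f" for f
  proof -
    define h where "h = (\<lambda>t. f (p(0 := t)))"
    have eq: "in_chart line_chart f (p(0 := t)) = h t" for t
      unfolding h_def by (intro in_chart_line_chart fun_upd_in_Euclidean_space assms) simp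
    have "smooth_on_open 1 line_space (in_chart line_chart f)"
      using f by (simp add: smooth_fun_def)
    \<comment> \<open>The derivative of order zero of a smooth function is partially differentiable.\<close>
    then have "(\<lambda>t. pds [] (in_chart line_chart f) (p(0 := t))) differentiable at (p 0)"
      using assms unfolding smooth_on_open_def by (metis empty_subsetI list.set(1) zero_less_one)
    then have "(h has_real_derivative deriv h (p 0)) (at (p 0))"
      by (simp add: eq DERIV_deriv_iff_real_differentiable)
    then have "((\<lambda>s. h (p 0 + s * a)) has_real_derivative deriv h (p 0) * a) (at 0)"
      by (intro DERIV_chain2[where f = h]) (auto intro!: derivative_eq_intros)
    then show ?thesis
      by (simp add: DERIV_imp_deriv h_def pd_def mult.commute)
  qed
  then show ?thesis
    using assms by (auto simp: velocity_def coord_vec_flat_line fun_eq_iff)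
qed

lemma complete_riemannian_flat_line: "complete_riemannian flat_line"
  unfolding complete_riemannian_def
proof (intro conjI ballI riemannian_manifold_flat_line)
  fix p v assume "v \<in> tangent_space flat_line p"
  then obtain a where p: "p \<in> line_space"
    and v: "v = (\<lambda>f. a * coord_vec flat_line line_chart 0 p f)"
    by (rule tangent_space_flat_line)
  show "\<exists>\<gamma>. geodesic_line flat_line \<gamma> \<and> \<gamma> 0 = p \<and> velocity flat_line \<gamma> 0 = v"
    using geodesic_line_affine_curve[OF p, of a] velocity_affine_curve[OF p, of a]
    by (intro exI[of _ "\<lambda>s. p(0 := p 0 + s * a)"]) (auto simp: v)
qed

section \<open>Linear weights of growing slope\<close>

lemma bakry_emery_nonneg_linear: "bakry_emery_nonneg flat_line (\<lambda>q. c * q 0)"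
  by (simp add: bakry_emery_nonneg_def lessThan_Suc ricci_flat_line hessian_flat_line
      pd_coordinate pd_const)

text \<open>
  The flux \<open>e\<^bsup>-f\<^esup> u'\<close> of the exponential with the same slope as the weight is the
  constant \<open>c\<close>, so its divergence vanishes.
\<close>

lemma f_harmonic_exp_linear: "f_harmonic flat_line (\<lambda>q. c * q 0) (\<lambda>q. exp (c * q 0))"
proof -
  have "(\<lambda>y. exp (- (c * y 0)) * pd 0 (\<lambda>q. exp (c * q 0)) y) = (\<lambda>_. c)"
    by (simp add: pd_exp fun_eq_iff exp_minus)
  then show ?thesis
    by (simp add: f_harmonic_def f_laplacian_flat_line pd_const)
qed

theorem theorem4:
  shows "\<exists>(M :: manifold) (f :: nat \<Rightarrow> (nat \<Rightarrow> real) \<Rightarrow> real) (u :: nat \<Rightarrow> (nat \<Rightarrow> real) \<Rightarrow> real).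
    complete_riemannian M \<and>
    (\<forall>k. smooth_fun M (f k) \<and> smooth_fun M (u k)) \<and>
    (\<forall>k. bakry_emery_nonneg M (f k)) \<and>
    (\<forall>k. f_harmonic M (f k) (u k) \<and> (\<forall>p\<in>topspace (mtop M). u k p > 0)) \<and>
    (\<exists>x\<in>topspace (mtop M). \<exists>y\<in>topspace (mtop M).
       filterlim (\<lambda>k. u k x / u k y) at_top sequentially)"
proof -
  define f where "f k = (\<lambda>q :: nat \<Rightarrow> real. real k * q 0)" for k
  define u where "u k = (\<lambda>q :: nat \<Rightarrow> real. exp (real k * q 0))" for k
  define y where "y = (\<lambda>_ :: nat. 0 :: real)"
  define x where "x = y(0 := 1)"
  have xy: "x \<in> line_space" "y \<in> line_space"
    by (auto simp: x_def y_def topspace_Euclidean_space)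
  have "filterlim (\<lambda>k. exp (real k)) at_top sequentially"
    by (rule filterlim_compose[OF exp_at_top filterlim_real_sequentially])
  then have "filterlim (\<lambda>k. u k x / u k y) at_top sequentially"
    by (simp add: u_def x_def y_def)
  moreover have "smooth_fun flat_line (f k) \<and> smooth_fun flat_line (u k)" for k
    unfolding f_def u_def
    by (intro conjI smooth_fun_flat_line smooth_on_open_coordinate smooth_on_open_exp)
  moreover have "f_harmonic flat_line (f k) (u k)" "bakry_emery_nonneg flat_line (f k)" for k
    unfolding f_def u_def by (rule f_harmonic_exp_linear bakry_emery_nonneg_linear)+
  moreover have "u k p > 0" for k p
    by (simp add: u_def)
  ultimately show ?thesis
    using complete_riemannian_flat_line xy
    by (intro exI[of _ flat_line] exI[of _ f] exI[of _ u]) auto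
qed

end
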